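(* Let $\mathbf G$ be a finite abelian group of order $N\ge 2$, let $A\subseteq\mathbf G$ be nonempty with $|A|=\delta N$, and for each integer $j\ge1$ let $\kappa_j$ be defined by $\mathsf{E}_j(A)=\kappa_j|A|^{j+1}$. For $\alpha\in(0,1]$ let $R_\alpha=\{r\in\widehat{\mathbf G}: |\widehat A(r)|\ge\alpha|A|\}$. Then for every integer $k\ge1$ and every $\alpha\in(0,1]$, $$|R_\alpha|\le \alpha^{-3}\delta^{-1}\big(\kappa_{2k}-\delta^{2k-1}\big)^{1/(2k)}\quad\text{and}\quad \max_{r\neq 0}|\widehat A(r)|\ge k^{-1/2}\big(\kappa_k-\delta^{k-1}\big)^{1/2}|A|.$$ Moreover, for every integer $k\ge3$ one has $\kappa_k\ge\kappa_{k-1}^{\frac{k-1}{k-2}}\ge\delta\kappa_{k-1}$, and for every integer $k\ge 2$, $$\max_{r\neq0}|\widehat A(r)|\ge(\kappa_k-\delta\kappa_{k-1})^{1/2}|A|.$$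
   Context: $\widehat{\mathbf G}$ is the dual group of characters of $\mathbf G$; for $f:\mathbf G\to\mathbb C$, $\widehat f(r)=\sum_{x\in\mathbf G}f(x)\overline{r(x)}$, and $A$ is identified with its indicator function. "$r\neq 0$" means $r$ is a nontrivial character. $(A\circ A)(x)=|\{(a,b)\in A^2:b-a=x\}|$, $\mathsf E_j(A)=\sum_x(A\circ A)(x)^j$ for $j\ge2$ and $\mathsf E_1(A)=|A|^2$.
   Formalization: The set R_α is taken over nontrivial characters r ≠ 0 only; with the trivial character included the first bound is false, e.g. for A = G the right side is 0 while |R_α| ≥ 1. *)

theory Defs
  imports Complex_Main "HOL-Library.Cardinality"
begin

definition characters :: "('a::{ab_group_add,finite} \<Rightarrow> complex) set" where
  "characters = {\<chi>. (\<forall>x y. \<chi> (x + y) = \<chi> x * \<chi> y) \<and> (\<forall>x. norm (\<chi> x) = 1)}"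

definition triv_char :: "'a::{ab_group_add,finite} \<Rightarrow> complex" where
  "triv_char = (\<lambda>x. 1)"

definition fourier :: "('a::{ab_group_add,finite} \<Rightarrow> complex) \<Rightarrow> ('a \<Rightarrow> complex) \<Rightarrow> complex" where
  "fourier f r = (\<Sum>x\<in>UNIV. f x * cnj (r x))"

definition set_fourier :: "'a::{ab_group_add,finite} set \<Rightarrow> ('a \<Rightarrow> complex) \<Rightarrow> complex" where
  "set_fourier A r = fourier (\<lambda>x. if x \<in> A then 1 else 0) r"

definition diff_count :: "'a::{ab_group_add,finite} set \<Rightarrow> 'a \<Rightarrow> nat" where
  "diff_count A x = card {(a, b). a \<in> A \<and> b \<in> A \<and> b - a = x}"

definition energy :: "nat \<Rightarrow> 'a::{ab_group_add,finite} set \<Rightarrow> real" where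
  "energy j A = (if j = 1 then real (card A) ^ 2 else (\<Sum>x\<in>UNIV. real (diff_count A x) ^ j))"

definition kappa :: "nat \<Rightarrow> 'a::{ab_group_add,finite} set \<Rightarrow> real" where
  "kappa j A = energy j A / real (card A) ^ (j + 1)"

definition density :: "'a::{ab_group_add,finite} set \<Rightarrow> real" where
  "density A = real (card A) / real CARD('a)"

definition large_spec :: "real \<Rightarrow> 'a::{ab_group_add,finite} set \<Rightarrow> ('a \<Rightarrow> complex) set" where
  "large_spec \<alpha> A = {r \<in> characters. r \<noteq> triv_char \<and> norm (set_fourier A r) \<ge> \<alpha> * real (card A)}"

definition max_nontriv_coeff :: "'a::{ab_group_add,finite} set \<Rightarrow> real" where
  "max_nontriv_coeff A = Max ((\<lambda>r. norm (set_fourier A r)) ` (characters - {triv_char}))"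

end

theory Submission
  imports Defs "HOL-Analysis.Convex"
begin

text \<open>
  By Fourier inversion the difference function \<open>A \<circ> A\<close> is \<open>|A|\<^sup>2 / N\<close> plus a balanced part
  \<open>h\<close> whose coefficients \<open>|A^(r)|\<^sup>2 / N\<close>, \<open>r \<noteq> 0\<close>, are nonnegative, and products of functions with
  nonnegative coefficients again have nonnegative coefficients.
  Hence the energy of order \<open>2k\<close> exceeds its trivial part by at least the sum of \<open>h\<^bsup>2k\<^esup>\<close>. By
  coefficient comparison this sum dominates the \<open>2k\<close>-th moment of any sum of the characters in the
  large spectrum with unimodular weights, and Hoelder's inequality on \<open>A\<close> bounds that moment from
  below. For the largest coefficient \<open>M\<close>, pairing
  \<open>(A \<circ> A)\<^bsup>k-1\<^esup>\<close> with \<open>h\<close> gives at most \<open>M\<^sup>2 |A|\<^bsup>k-1\<^esup>\<close>, which is the last inequality; telescoping it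
  gives the second one. The inequalities between consecutive \<open>\<kappa>\<^sub>k\<close> follow from log-convexity.
\<close>

section \<open>Characters separate points\<close>

primrec nat_scale :: "nat \<Rightarrow> 'a::ab_group_add \<Rightarrow> 'a" where
  "nat_scale 0 g = 0"
| "nat_scale (Suc n) g = g + nat_scale n g"

lemma nat_scale_add: "nat_scale (m + n) g = nat_scale m g + nat_scale n g"
  by (induction m) (auto simp: algebra_simps)

lemma nat_scale_mult: "nat_scale (m * n) g = nat_scale m (nat_scale n g)"
  by (induction m) (auto simp: nat_scale_add)

text \<open>A character of the subgroup \<open>H\<close>; containing \<open>0\<close> and being
  closed under differences is the subgroup property. Values outside \<open>H\<close> are arbitrary,
  so extending means agreeing on \<open>H\<close>.\<close>

definition partial_character :: "'a::ab_group_add set \<Rightarrow> ('a \<Rightarrow> complex) \<Rightarrow> bool" where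
  "partial_character H \<chi> \<longleftrightarrow> 0 \<in> H \<and> (\<forall>x\<in>H. \<forall>y\<in>H. x - y \<in> H) \<and>
     (\<forall>x\<in>H. \<forall>y\<in>H. \<chi> (x + y) = \<chi> x * \<chi> y) \<and> (\<forall>x\<in>H. norm (\<chi> x) = 1)"

lemma partial_characterD:
  assumes "partial_character H \<chi>"
  shows "0 \<in> H" and "\<And>x y. x \<in> H \<Longrightarrow> y \<in> H \<Longrightarrow> x - y \<in> H"
    and "\<And>x. x \<in> H \<Longrightarrow> - x \<in> H" and "\<And>x y. x \<in> H \<Longrightarrow> y \<in> H \<Longrightarrow> x + y \<in> H"
    and "\<And>x y. x \<in> H \<Longrightarrow> y \<in> H \<Longrightarrow> \<chi> (x + y) = \<chi> x * \<chi> y"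
    and "\<And>x. x \<in> H \<Longrightarrow> norm (\<chi> x) = 1"
    and "\<chi> 0 = 1" and "\<And>x n. x \<in> H \<Longrightarrow> nat_scale n x \<in> H"
    and "\<And>x n. x \<in> H \<Longrightarrow> \<chi> (nat_scale n x) = \<chi> x ^ n"
proof -
  show zero: "0 \<in> H" using assms by (auto simp: partial_character_def)
  show diff: "x - y \<in> H" if "x \<in> H" "y \<in> H" for x y
    using assms that by (auto simp: partial_character_def)
  show minus: "- x \<in> H" if "x \<in> H" for x using diff[OF zero that] by simp
  show add: "x + y \<in> H" if "x \<in> H" "y \<in> H" for x y
    using diff[OF that(1) minus[OF that(2)]] by simp
  show mult: "\<chi> (x + y) = \<chi> x * \<chi> y" if "x \<in> H" "y \<in> H" for x y
    using assms that by (auto simp: partial_character_def)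
  show norm: "norm (\<chi> x) = 1" if "x \<in> H" for x
    using assms that by (auto simp: partial_character_def)
  show one: "\<chi> 0 = 1" using mult[OF zero zero] norm[OF zero] by auto
  show scale: "nat_scale n x \<in> H" if "x \<in> H" for x n
    using that by (induction n) (auto intro: zero add)
  show "\<chi> (nat_scale n x) = \<chi> x ^ n" if "x \<in> H" for x n
    using that by (induction n) (auto simp: one mult scale)
qed

lemma nat_scale_periodic:
  fixes g :: "'a::{ab_group_add,finite}"
  shows "\<exists>m>0. nat_scale m g = 0"
proof -
  have "\<not> inj (\<lambda>n. nat_scale n g)"
    using finite_imageD[of "\<lambda>n. nat_scale n g" UNIV] by auto
  then obtain i j where "nat_scale i g = nat_scale j g" "i < j"
    unfolding inj_def by (metis linorder_neqE_nat)
  then have "nat_scale (j - i) g = 0"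
    using nat_scale_add[of i "j - i" g] by simp
  with \<open>i < j\<close> show ?thesis by (intro exI[of _ "j - i"]) simp
qed

text \<open>All relations between \<open>g\<close> and \<open>H\<close> follow from
  \<open>nat_scale m g \<in> H\<close>, so any \<open>m\<close>-th root \<open>z\<close> of the
  value there can be assigned to \<open>g\<close>. The choice of \<open>z\<close> stays free because
  the separation of points prescribes it.\<close>

lemma partial_character_extend:
  fixes H :: "'a::{ab_group_add,finite} set"
  assumes H: "partial_character H \<chi>" and "m > 0" "nat_scale m g \<in> H"
    and least: "\<And>n. 0 < n \<Longrightarrow> n < m \<Longrightarrow> nat_scale n g \<notin> H"
    and z: "z ^ m = \<chi> (nat_scale m g)"
  obtains H' \<chi>' where "partial_character H' \<chi>'" "H \<subseteq> H'" "g \<in> H'"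
    "\<And>h. h \<in> H \<Longrightarrow> \<chi>' h = \<chi> h" "\<chi>' g = z"
proof -
  note D = partial_characterD[OF H]
  define H' where "H' = {h + nat_scale n g | h n. h \<in> H}"
  \<comment> \<open>Division with remainder: the remainder also gives a multiple of \<open>g\<close>
    in \<open>H\<close>, so minimality of \<open>m\<close> makes it zero.\<close>
  have dvd: "m dvd n" if "nat_scale n g \<in> H" for n
  proof -
    have "nat_scale n g = nat_scale (n div m) (nat_scale m g) + nat_scale (n mod m) g"
      by (simp flip: nat_scale_mult nat_scale_add)
    then have "nat_scale (n mod m) g = nat_scale n g - nat_scale (n div m) (nat_scale m g)"
      by simp
    then have "nat_scale (n mod m) g \<in> H"
      using D(2)[OF that D(8)[OF assms(3)]] by simp
    then have "n mod m = 0" using least[of "n mod m"] \<open>m > 0\<close> by fastforce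
    then show ?thesis by (simp add: dvd_eq_mod_eq_0)
  qed
  \<comment> \<open>Exponents are natural numbers, so independence of the representation is first
    shown for \<open>n \<le> n'\<close>, where \<open>n' - n\<close> is a multiple of
    \<open>m\<close>.\<close>
  have ordered: "\<chi> h * z ^ n = \<chi> h' * z ^ n'"
    if "h \<in> H" "h' \<in> H" "h + nat_scale n g = h' + nat_scale n' g" "n \<le> n'" for h h' n n'
  proof -
    have "nat_scale n' g = nat_scale n g + nat_scale (n' - n) g"
      using nat_scale_add[of n "n' - n" g] that(4) by simp
    then have h: "h = h' + nat_scale (n' - n) g"
      using that(3) by (simp add: algebra_simps)
    then have "nat_scale (n' - n) g = h - h'" by simp
    then have "nat_scale (n' - n) g \<in> H" using D(2)[OF that(1,2)] by simp
    moreover from dvd[OF this] obtain q where q: "n' - n = q * m" by (auto simp: dvd_def mult.commute)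
    ultimately have "\<chi> h = \<chi> h' * \<chi> (nat_scale q (nat_scale m g))"
      using h D(5)[OF that(2)] by (simp add: nat_scale_mult)
    also have "\<chi> (nat_scale q (nat_scale m g)) = z ^ (n' - n)"
      unfolding D(9)[OF assms(3)] q z[symmetric] by (simp add: mult.commute flip: power_mult)
    finally show ?thesis using that(4) by (simp flip: power_add)
  qed
  have well_defined: "\<chi> h * z ^ n = \<chi> h' * z ^ n'"
    if "h \<in> H" "h' \<in> H" "h + nat_scale n g = h' + nat_scale n' g" for h h' n n'
    using ordered[OF that] ordered[OF that(2,1) that(3)[symmetric]] by (cases "n \<le> n'") auto
  define \<chi>' where "\<chi>' x = (SOME w. \<exists>h n. h \<in> H \<and> x = h + nat_scale n g \<and> w = \<chi> h * z ^ n)" for x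
  have val: "\<chi>' (h + nat_scale n g) = \<chi> h * z ^ n" if "h \<in> H" for h n
    unfolding \<chi>'_def using that by (intro some_equality) (auto intro: well_defined)
  have "norm z ^ m = 1" using z D(6)[OF assms(3)] by (simp flip: norm_power)
  then have norm_z: "norm z = 1" using \<open>m > 0\<close> power_eq_1_iff[of "norm z" m] by simp
  obtain e where e: "e > 0" "nat_scale e g = 0" using nat_scale_periodic by blast
  \<comment> \<open>\<open>H'\<close> consists of sums with natural multiples of \<open>g\<close>;
    the period \<open>e\<close> rewrites negatives as such multiples, which gives closure under
    differences.\<close>
  have minus: "- nat_scale n g = nat_scale (n * (e - 1)) g" for n
  proof -
    have "nat_scale n g + nat_scale (n * (e - 1)) g = nat_scale (n * e) g"
      using e(1) by (simp flip: nat_scale_add add: algebra_simps)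
    also have "\<dots> = 0"
    proof -
      have "nat_scale n (0::'a) = 0" by (induction n) auto
      then show ?thesis by (simp add: nat_scale_mult e)
    qed
    finally show ?thesis by (simp add: minus_unique)
  qed
  have "partial_character H' \<chi>'"
    unfolding partial_character_def
  proof (intro conjI ballI)
    show "0 \<in> H'" unfolding H'_def using D(1) by (auto intro!: exI[of _ 0])
  next
    fix x y assume "x \<in> H'" "y \<in> H'"
    then obtain h n h' n' where xy: "x = h + nat_scale n g" "h \<in> H" "y = h' + nat_scale n' g" "h' \<in> H"
      by (auto simp: H'_def)
    have "x - y = (h - h') + nat_scale (n + n' * (e - 1)) g"
      unfolding xy nat_scale_add minus[of n', symmetric] by (simp add: algebra_simps)
    then show "x - y \<in> H'" using D(2)[OF xy(2,4)] unfolding H'_def by blast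
    have "x + y = (h + h') + nat_scale (n + n') g"
      using xy by (simp add: nat_scale_add algebra_simps)
    then have "\<chi>' (x + y) = \<chi> (h + h') * z ^ (n + n')"
      using val[OF D(4)[OF xy(2,4)]] by simp
    then show "\<chi>' (x + y) = \<chi>' x * \<chi>' y"
      using xy val D(5) by (simp add: power_add)
  next
    fix x assume "x \<in> H'"
    then show "norm (\<chi>' x) = 1"
      by (auto simp: H'_def val norm_mult norm_power norm_z D(6))
  qed
  moreover have mem: "h + nat_scale n g \<in> H'" if "h \<in> H" for h n
    unfolding H'_def using that by blast
  have "h \<in> H'" "\<chi>' h = \<chi> h" if "h \<in> H" for h
    using val[OF that, of 0] mem[OF that, of 0] by simp_all
  moreover have "g \<in> H'" "\<chi>' g = z"
    using val[OF D(1), of 1] mem[OF D(1), of 1] D(7) by simp_all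
  ultimately show thesis by (intro that[of H' \<chi>']) auto
qed

lemma partial_character_least_multiple:
  fixes g :: "'a::{ab_group_add,finite}"
  assumes "partial_character H \<chi>"
  obtains m where "m > 0" "nat_scale m g \<in> H" "\<And>n. 0 < n \<Longrightarrow> n < m \<Longrightarrow> nat_scale n g \<notin> H"
proof -
  let ?P = "\<lambda>m. m > 0 \<and> nat_scale m g \<in> H"
  have "\<exists>m. ?P m" using nat_scale_periodic[of g] partial_characterD(1)[OF assms] by metis
  then have *: "?P (Least ?P)" by (rule LeastI_ex)
  show thesis
  proof (rule that)
    show "Least ?P > 0" "nat_scale (Least ?P) g \<in> H" using * by auto
    show "nat_scale n g \<notin> H" if "0 < n" "n < Least ?P" for n
      using not_less_Least[OF that(2)] that(1) by simp
  qed
qed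

lemma complex_nth_root_exists:
  fixes w :: complex
  assumes "m > 0"
  shows "\<exists>z. z ^ m = w"
proof -
  have "(rcis (root m (norm w)) (Arg w / m)) ^ m = rcis (norm w) (Arg w)"
    using assms by (simp add: DeMoivre2)
  then show ?thesis by (metis rcis_cmod_Arg)
qed

text \<open>Induction on the number of elements outside \<open>H\<close>: adjoining some
  \<open>g \<notin> H\<close> lowers it.\<close>

lemma partial_character_extends_to_character:
  fixes H :: "'a::{ab_group_add,finite} set"
  assumes "partial_character H \<chi>"
  shows "\<exists>\<psi>\<in>characters. \<forall>h\<in>H. \<psi> h = \<chi> h"
  using assms
proof (induction "card (- H)" arbitrary: H \<chi> rule: less_induct)
  case less
  show ?case
  proof (cases "H = UNIV")
    case True
    with less.prems show ?thesis
      by (intro bexI[of _ \<chi>]) (auto simp: partial_character_def characters_def)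
  next
    case False
    then obtain g where g: "g \<notin> H" by auto
    obtain m where m: "m > 0" "nat_scale m g \<in> H"
        "\<And>n. 0 < n \<Longrightarrow> n < m \<Longrightarrow> nat_scale n g \<notin> H"
      using partial_character_least_multiple[OF less.prems] by blast
    obtain z where "z ^ m = \<chi> (nat_scale m g)" using complex_nth_root_exists[OF m(1)] by blast
    from partial_character_extend[OF less.prems m this] obtain H' \<chi>' where
      H': "partial_character H' \<chi>'" "H \<subseteq> H'" "g \<in> H'" "\<And>h. h \<in> H \<Longrightarrow> \<chi>' h = \<chi> h"
      by metis
    have "card (- H') < card (- H)" using H'(2,3) g by (intro psubset_card_mono) auto
    from less.hyps[OF this H'(1)] H'(2,4) show ?thesis by (metis subsetD)
  qed
qed

text \<open>Adjoin \<open>g\<close> to the trivial subgroup. Then \<open>m\<close> is the order of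
  \<open>g\<close>, at least 2, so a primitive \<open>m\<close>-th root of unity is an admissible
  value at \<open>g\<close> different from 1.\<close>

lemma characters_separate:
  fixes g :: "'a::{ab_group_add,finite}"
  assumes "g \<noteq> 0"
  shows "\<exists>\<chi>\<in>characters. \<chi> g \<noteq> 1"
proof -
  have zero: "partial_character {0::'a} (\<lambda>_. 1)" by (simp add: partial_character_def)
  obtain m where m: "m > 0" "nat_scale m g \<in> {0}"
      "\<And>n. 0 < n \<Longrightarrow> n < m \<Longrightarrow> nat_scale n g \<notin> {0}"
    using partial_character_least_multiple[OF zero] by blast
  have "m \<noteq> 1" using m(2) assms by auto
  with m(1) have "m \<ge> 2" by simp
  define z where "z = cis (2 * pi / m)"
  have "z ^ m = 1" using m(1) by (simp add: z_def DeMoivre)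
  moreover have "z \<noteq> 1"
  proof
    assume "z = 1"
    then have "cos (2 * pi / m) = 1" by (metis z_def cis.simps(1) one_complex.simps(1))
    moreover have "cos (2 * pi / m) < cos 0"
      using \<open>m \<ge> 2\<close> by (intro cos_monotone_0_pi) (auto simp: field_simps)
    ultimately show False by simp
  qed
  ultimately show ?thesis
    using partial_character_extend[OF zero m, of z] partial_character_extends_to_character
    by metis
qed

section \<open>Orthogonality and positive definiteness\<close>

lemma characterD:
  assumes "\<chi> \<in> characters"
  shows "\<chi> (x + y) = \<chi> x * \<chi> y" "norm (\<chi> x) = 1" "\<chi> 0 = 1"
    "\<chi> x * cnj (\<chi> x) = 1" "\<chi> (- x) = cnj (\<chi> x)"
proof -
  show mult: "\<chi> (x + y) = \<chi> x * \<chi> y" for x y using assms by (auto simp: characters_def)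
  show norm: "norm (\<chi> x) = 1" for x using assms by (auto simp: characters_def)
  show one: "\<chi> 0 = 1" using mult[of 0 0] norm[of 0] by auto
  show unit: "\<chi> x * cnj (\<chi> x) = 1" for x
    using norm[of x] by (simp add: complex_norm_square[symmetric])
  have "\<chi> x * \<chi> (- x) = \<chi> x * cnj (\<chi> x)" using mult[of x "- x"] one unit by simp
  moreover have "\<chi> x \<noteq> 0" using norm[of x] by auto
  ultimately show "\<chi> (- x) = cnj (\<chi> x)" by simp
qed

lemma triv_char_character [simp]: "triv_char \<in> characters"
  by (auto simp: characters_def triv_char_def)

lemma triv_char_apply [simp]: "triv_char x = 1"
  by (simp add: triv_char_def)

lemma characters_mult:
  "\<chi> \<in> characters \<Longrightarrow> \<psi> \<in> characters \<Longrightarrow> (\<lambda>x. \<chi> x * \<psi> x) \<in> characters"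
  by (auto simp: characters_def norm_mult)

lemma characters_cnj: "\<chi> \<in> characters \<Longrightarrow> (\<lambda>x. cnj (\<chi> x)) \<in> characters"
  by (auto simp: characters_def)

text \<open>Every value is a root of unity of exponent \<open>CARD('a)\<close>: translating by
  \<open>x\<close> leaves the product of \<chi> over the group fixed, yet multiplies it by that
  power of \<open>\<chi> x\<close>.\<close>

lemma finite_characters [simp]:
  "finite (characters :: ('a::{ab_group_add,finite} \<Rightarrow> complex) set)"
proof -
  let ?Z = "{z::complex. z ^ CARD('a) = 1}"
  have "finite ?Z" by (rule finite_roots_unity) (simp add: Suc_leI)
  then have "finite {f :: 'a \<Rightarrow> complex. \<forall>x. (x \<in> UNIV \<longrightarrow> f x \<in> ?Z) \<and> (x \<notin> UNIV \<longrightarrow> f x = 0)}"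
    by (intro finite_set_of_finite_funs) auto
  moreover have "\<chi> x \<in> ?Z" if "\<chi> \<in> characters" for \<chi> and x :: 'a
  proof -
    have "(\<Prod>y\<in>UNIV. \<chi> y) = (\<Prod>y\<in>UNIV. \<chi> (x + y))"
      by (rule prod.reindex_bij_betw[symmetric])
        (auto intro!: bij_betw_byWitness[of _ "\<lambda>y. y - x"])
    also have "\<dots> = \<chi> x ^ CARD('a) * (\<Prod>y\<in>UNIV. \<chi> y)"
      using characterD(1)[OF that] by (simp add: prod.distrib)
    moreover have "(\<Prod>y\<in>UNIV. \<chi> y) \<noteq> 0"
      using characterD(2)[OF that] by (auto simp: prod_zero_iff) (metis norm_zero zero_neq_one)
    ultimately show ?thesis by simp
  qed
  ultimately show ?thesis by (elim finite_subset[rotated]) auto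
qed

text \<open>Translation by some \<open>y\<close> with \<open>\<chi> y \<noteq> 1\<close> permutes
  the group but multiplies the sum by \<open>\<chi> y\<close>.\<close>

lemma sum_character:
  fixes \<chi> :: "'a::{ab_group_add,finite} \<Rightarrow> complex"
  assumes "\<chi> \<in> characters"
  shows "(\<Sum>x\<in>UNIV. \<chi> x) = (if \<chi> = triv_char then of_nat CARD('a) else 0)"
proof (cases "\<chi> = triv_char")
  case False
  then obtain y where y: "\<chi> y \<noteq> 1" by (auto simp: triv_char_def)
  have "(\<Sum>x\<in>UNIV. \<chi> x) = (\<Sum>x\<in>UNIV. \<chi> (y + x))"
    by (rule sum.reindex_bij_betw[symmetric])
      (auto intro!: bij_betw_byWitness[of _ "\<lambda>z. z - y"])
  also have "\<dots> = \<chi> y * (\<Sum>x\<in>UNIV. \<chi> x)"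
    using characterD(1)[OF assms] by (simp add: sum_distrib_left)
  finally show ?thesis using y False by simp
qed (simp add: triv_char_def)

lemma character_quotient_triv:
  assumes "\<chi> \<in> characters" "\<psi> \<in> characters"
  shows "(\<lambda>x. \<chi> x * cnj (\<psi> x)) = triv_char \<longleftrightarrow> \<chi> = \<psi>"
proof
  assume *: "(\<lambda>x. \<chi> x * cnj (\<psi> x)) = triv_char"
  show "\<chi> = \<psi>"
  proof
    fix x
    have "\<chi> x * (\<psi> x * cnj (\<psi> x)) = \<psi> x"
      using fun_cong[OF *, of x] by (simp add: triv_char_def)
    then show "\<chi> x = \<psi> x" using characterD(4)[OF assms(2)] by simp
  qed
qed (use characterD(4)[OF assms(1)] in \<open>auto simp: triv_char_def\<close>)

lemma characters_reindex:
  assumes "\<psi> \<in> characters"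
  shows "(\<Sum>\<chi>\<in>characters. F \<chi>) = (\<Sum>\<chi>\<in>characters. F (\<lambda>x. \<chi> x * \<psi> x))"
  by (intro sum.reindex_bij_witness[of _ "\<lambda>\<chi> x. \<chi> x * \<psi> x" "\<lambda>\<chi> x. \<chi> x * cnj (\<psi> x)"])
    (auto simp: characters_mult characters_cnj assms mult.assoc characterD(4)[OF assms]
      characterD(4)[OF assms, unfolded mult.commute[of "\<psi> _"]])

text \<open>For \<open>g \<noteq> 0\<close>, multiplication by a character separating
  \<open>g\<close> from 0 permutes the dual group and forces the sum to vanish.\<close>

lemma sum_over_characters:
  fixes g :: "'a::{ab_group_add,finite}"
  shows "(\<Sum>\<chi>\<in>characters. \<chi> g) = (if g = 0 then of_nat CARD('a) else 0)"
proof -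
  have off: "(\<Sum>\<chi>\<in>characters. \<chi> g) = 0" if g: "g \<noteq> 0" for g :: 'a
  proof -
    obtain \<psi> where \<psi>: "\<psi> \<in> characters" "\<psi> g \<noteq> 1" using characters_separate[OF g] by blast
    have "(\<Sum>\<chi>\<in>characters. \<chi> g) = (\<Sum>\<chi>\<in>characters. \<chi> g) * \<psi> g"
      unfolding sum_distrib_right by (rule characters_reindex[OF \<psi>(1), of "\<lambda>\<chi>. \<chi> g"])
    then show ?thesis using \<psi>(2) by simp
  qed
  \<comment> \<open>The number of characters is found by double counting: of the sum over all
    \<open>g\<close> and \<chi>, only \<open>g = 0\<close> survives in one order and only
    \<open>triv_char\<close> in the other.\<close>
  have "(\<Sum>\<chi>\<in>characters. \<chi> (0::'a)) = (\<Sum>g\<in>UNIV. \<Sum>\<chi>\<in>characters. \<chi> (g::'a))"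
    using off by (subst sum.remove[of UNIV 0]) auto
  also have "\<dots> = (\<Sum>\<chi>\<in>characters. \<Sum>g\<in>UNIV. \<chi> (g::'a))" by (rule sum.swap)
  also have "\<dots> = of_nat CARD('a)" by (simp add: sum_character sum.delta)
  finally show ?thesis using off by auto
qed

text \<open>Fourier synthesis without the factor 1/N, which the coefficients carry instead.\<close>

definition char_sum :: "(('a::{ab_group_add,finite} \<Rightarrow> complex) \<Rightarrow> complex) \<Rightarrow> 'a \<Rightarrow> complex" where
  "char_sum p x = (\<Sum>\<chi>\<in>characters. p \<chi> * \<chi> x)"

lemma parseval:
  fixes p q :: "('a::{ab_group_add,finite} \<Rightarrow> complex) \<Rightarrow> complex"
  shows "(\<Sum>x\<in>UNIV. char_sum p x * cnj (char_sum q x)) =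
    of_nat CARD('a) * (\<Sum>\<chi>\<in>characters. p \<chi> * cnj (q \<chi>))"
proof -
  have "(\<Sum>x\<in>UNIV. char_sum p x * cnj (char_sum q x)) =
      (\<Sum>x\<in>UNIV. \<Sum>\<chi>\<in>characters. \<Sum>\<psi>\<in>characters. p \<chi> * cnj (q \<psi>) * (\<chi> x * cnj (\<psi> x)))"
    by (simp add: char_sum_def sum_product mult_ac)
  also have "\<dots> = (\<Sum>\<chi>\<in>characters. \<Sum>\<psi>\<in>characters. \<Sum>x\<in>UNIV. p \<chi> * cnj (q \<psi>) * (\<chi> x * cnj (\<psi> x)))"
    by (subst sum.swap, rule sum.cong[OF refl], rule sum.swap)
  also have "\<dots> = (\<Sum>\<chi>\<in>characters. \<Sum>\<psi>\<in>characters.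
      if \<psi> = \<chi> then of_nat CARD('a) * (p \<chi> * cnj (q \<psi>)) else 0)"
    by (intro sum.cong refl)
      (simp add: sum_character characters_mult characters_cnj character_quotient_triv
        flip: sum_distrib_left)
  also have "\<dots> = of_nat CARD('a) * (\<Sum>\<chi>\<in>characters. p \<chi> * cnj (q \<chi>))"
    by (simp add: sum_distrib_left)
  finally show ?thesis .
qed

text \<open>Pointwise products correspond to convolution on the dual group, where the inverse of a
  character is its conjugate.\<close>

lemma char_sum_mult:
  "char_sum p x * char_sum q x =
    char_sum (\<lambda>\<chi>. \<Sum>\<psi>\<in>characters. p (\<lambda>y. \<chi> y * cnj (\<psi> y)) * q \<psi>) x"
proof -
  have *: "(\<lambda>y. \<chi> y * \<psi> y * cnj (\<psi> y)) = \<chi>" if "\<psi> \<in> characters" for \<chi> \<psi> :: "'a \<Rightarrow> complex"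
    using characterD(4)[OF that] by (simp add: mult.assoc)
  have "char_sum p x * char_sum q x =
      (\<Sum>\<psi>\<in>characters. \<Sum>\<chi>\<in>characters. p \<chi> * q \<psi> * (\<chi> x * \<psi> x))"
    unfolding char_sum_def by (subst sum.swap) (simp add: sum_product mult_ac)
  also have "\<dots> = (\<Sum>\<psi>\<in>characters. \<Sum>\<chi>\<in>characters. p (\<lambda>y. \<chi> y * cnj (\<psi> y)) * q \<psi> * \<chi> x)"
  proof (rule sum.cong[OF refl])
    fix \<psi> :: "'a \<Rightarrow> complex" assume \<psi>: "\<psi> \<in> characters"
    show "(\<Sum>\<chi>\<in>characters. p \<chi> * q \<psi> * (\<chi> x * \<psi> x)) =
        (\<Sum>\<chi>\<in>characters. p (\<lambda>y. \<chi> y * cnj (\<psi> y)) * q \<psi> * \<chi> x)"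
      by (subst (2) characters_reindex[OF \<psi>]) (simp add: *[OF \<psi>])
  qed
  also have "\<dots> = char_sum (\<lambda>\<chi>. \<Sum>\<psi>\<in>characters. p (\<lambda>y. \<chi> y * cnj (\<psi> y)) * q \<psi>) x"
    unfolding char_sum_def by (subst sum.swap) (simp add: sum_distrib_right)
  finally show ?thesis .
qed

text \<open>The relation \<open>majorised f f\<close> says that \<open>f\<close> is positive definite.\<close>

definition majorised :: "('a::{ab_group_add,finite} \<Rightarrow> complex) \<Rightarrow> ('a \<Rightarrow> complex) \<Rightarrow> bool" where
  "majorised f g \<longleftrightarrow> (\<exists>p (q :: _ \<Rightarrow> real). (\<forall>\<chi>\<in>characters. norm (p \<chi>) \<le> q \<chi>) \<and>
     (\<forall>x. f x = char_sum p x) \<and> (\<forall>x. g x = char_sum (\<lambda>\<chi>. of_real (q \<chi>)) x))"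

text \<open>By the triangle inequality, a convolution of coefficients is bounded by the convolution
  of their majorants.\<close>

lemma majorised_mult:
  assumes "majorised f g" "majorised f' g'"
  shows "majorised (\<lambda>x. f x * f' x) (\<lambda>x. g x * g' x)"
proof -
  obtain p q where pq: "\<And>\<chi>. \<chi> \<in> characters \<Longrightarrow> norm (p \<chi>) \<le> q \<chi>" "\<And>x. f x = char_sum p x"
      "\<And>x. g x = char_sum (\<lambda>\<chi>. of_real (q \<chi>)) x"
    using assms(1) unfolding majorised_def by blast
  obtain p' q' where pq': "\<And>\<chi>. \<chi> \<in> characters \<Longrightarrow> norm (p' \<chi>) \<le> q' \<chi>" "\<And>x. f' x = char_sum p' x"
      "\<And>x. g' x = char_sum (\<lambda>\<chi>. of_real (q' \<chi>)) x"
    using assms(2) unfolding majorised_def by blast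
  let ?p = "\<lambda>\<chi>. \<Sum>\<psi>\<in>characters. p (\<lambda>y. \<chi> y * cnj (\<psi> y)) * p' \<psi>"
  let ?q = "\<lambda>\<chi>. \<Sum>\<psi>\<in>characters. q (\<lambda>y. \<chi> y * cnj (\<psi> y)) * q' \<psi>"
  have "norm (?p \<chi>) \<le> ?q \<chi>" if "\<chi> \<in> characters" for \<chi>
  proof (rule sum_norm_le)
    fix \<psi> :: "'a \<Rightarrow> complex" assume "\<psi> \<in> characters"
    then show "norm (p (\<lambda>y. \<chi> y * cnj (\<psi> y)) * p' \<psi>) \<le> q (\<lambda>y. \<chi> y * cnj (\<psi> y)) * q' \<psi>"
      using pq(1)[of "\<lambda>y. \<chi> y * cnj (\<psi> y)"] pq'(1)[of \<psi>] characters_mult[OF that characters_cnj[of \<psi>]]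
      by (simp add: norm_mult) (metis mult_mono norm_ge_zero order_trans)
  qed
  then show ?thesis
    unfolding majorised_def
    by (intro exI[of _ ?p] exI[of _ ?q]) (simp add: pq pq' char_sum_mult)
qed

lemma char_sum_single:
  fixes x :: "'a::{ab_group_add,finite}"
  shows "char_sum (\<lambda>\<chi>. if \<chi> = triv_char then c else 0) x = c"
proof -
  have "char_sum (\<lambda>\<chi>. if \<chi> = triv_char then c else 0) x =
      (\<Sum>\<chi>\<in>characters. if \<chi> = (triv_char :: 'a \<Rightarrow> complex) then c else 0)"
    unfolding char_sum_def by (intro sum.cong) auto
  then show ?thesis by simp
qed

lemma majorised_one: "majorised (\<lambda>_. 1) (\<lambda>_. 1)"
  unfolding majorised_def
proof (intro exI conjI)
  show "\<forall>\<chi>\<in>characters. norm (if \<chi> = triv_char then 1 else 0 :: complex) \<le>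
      (if \<chi> = triv_char then 1 else 0)" by simp
qed (simp_all only: char_sum_single if_distrib[of of_real] of_real_1 of_real_0 simp_thms)

lemma majorised_power:
  assumes "majorised f g"
  shows "majorised (\<lambda>x. f x ^ n) (\<lambda>x. g x ^ n)"
  by (induction n) (auto intro: majorised_mult[OF assms] majorised_one)

text \<open>Parseval turns both sides into N times sums of squared coefficients, which compare
  termwise. Applied to \<open>k\<close>-th powers this compares moments of order
  \<open>2k\<close>.\<close>

lemma majorised_sum_norm_square:
  assumes "majorised f g"
  shows "(\<Sum>x\<in>UNIV. norm (f x) ^ 2) \<le> (\<Sum>x\<in>UNIV. norm (g x) ^ 2)"
proof -
  obtain p q where pq: "\<And>\<chi>. \<chi> \<in> characters \<Longrightarrow> norm (p \<chi>) \<le> q \<chi>" "\<And>x. f x = char_sum p x"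
      "\<And>x. g x = char_sum (\<lambda>\<chi>. of_real (q \<chi>)) x"
    using assms(1) unfolding majorised_def by blast
  have energy: "(\<Sum>x\<in>UNIV. norm (char_sum p x) ^ 2) = CARD('a) * (\<Sum>\<chi>\<in>characters. norm (p \<chi>) ^ 2)"
    for p :: "('a \<Rightarrow> complex) \<Rightarrow> complex"
  proof -
    have "of_real (\<Sum>x\<in>UNIV. norm (char_sum p x) ^ 2) =
        (of_real (CARD('a) * (\<Sum>\<chi>\<in>characters. norm (p \<chi>) ^ 2)) :: complex)"
      using parseval[of p p] by (simp add: complex_norm_square del: of_real_power)
    then show ?thesis by (simp only: of_real_eq_iff)
  qed
  have "norm (p \<chi>) ^ 2 \<le> norm (of_real (q \<chi>) :: complex) ^ 2" if "\<chi> \<in> characters" for \<chi>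
    using pq(1)[OF that] by (intro power_mono) auto
  then show ?thesis
    unfolding pq energy by (intro mult_left_mono sum_mono) auto
qed

text \<open>Summation over the group extracts N times the trivial coefficient.\<close>

lemma positive_definite_sum_nonneg:
  fixes f :: "'a::{ab_group_add,finite} \<Rightarrow> real"
  assumes "majorised (\<lambda>x. of_real (f x)) (\<lambda>x. of_real (f x))"
  shows "(\<Sum>x\<in>UNIV. f x) \<ge> 0"
proof -
  obtain p q where pq: "\<And>\<chi>. \<chi> \<in> characters \<Longrightarrow> norm (p \<chi> :: complex) \<le> q \<chi>"
      "\<And>x. of_real (f x) = char_sum (\<lambda>\<chi>. of_real (q \<chi>)) x"
    using assms(1) unfolding majorised_def by blast
  have "of_real (\<Sum>x\<in>UNIV. f x) = (\<Sum>x\<in>UNIV. char_sum (\<lambda>\<chi>. of_real (q \<chi>)) x)"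
    by (simp add: pq(2))
  also have "\<dots> = (\<Sum>\<chi>\<in>characters. of_real (q \<chi>) * (\<Sum>x\<in>UNIV. \<chi> x))"
    unfolding char_sum_def by (subst sum.swap) (simp add: sum_distrib_left)
  also have "\<dots> = of_real (q triv_char * CARD('a))"
    by (simp add: sum_character if_distrib[of "\<lambda>z. _ * z"] cong: if_cong)
  finally have "(\<Sum>x\<in>UNIV. f x) = q triv_char * CARD('a)" by (simp only: of_real_eq_iff)
  moreover have "q triv_char \<ge> 0" using order_trans[OF norm_ge_zero pq(1)[of triv_char]] by simp
  ultimately show ?thesis by simp
qed

section \<open>The difference function\<close>

lemma set_fourier_eq: "set_fourier A \<chi> = (\<Sum>x\<in>A. cnj (\<chi> x))"
proof -
  have "set_fourier A \<chi> = (\<Sum>x\<in>UNIV. if x \<in> A then cnj (\<chi> x) else 0)"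
    unfolding set_fourier_def fourier_def by (intro sum.cong) auto
  then show ?thesis by (simp add: sum.If_cases)
qed

lemma set_fourier_triv: "set_fourier A triv_char = of_nat (card A)"
  by (simp add: set_fourier_eq)

lemma diff_count_eq_sum:
  "(of_nat (diff_count A x) :: 'b::semiring_1) = (\<Sum>b\<in>A. \<Sum>a\<in>A. if b - a = x then 1 else 0)"
proof -
  have "diff_count A x = card {p \<in> A \<times> A. fst p - snd p = x}"
    unfolding diff_count_def
    by (rule bij_betw_same_card[of prod.swap])
      (auto intro!: bij_betw_byWitness[of _ prod.swap])
  also have "(of_nat \<dots> :: 'b) = (\<Sum>p\<in>A \<times> A. if fst p - snd p = x then 1 else 0)"
    by (simp add: sum.If_cases Int_def)
  finally show ?thesis by (simp add: sum.cartesian_product case_prod_unfold)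
qed

lemma diff_count_0: "diff_count A 0 = card A"
  using diff_count_eq_sum[of A 0, where 'b = nat] by simp

lemma sum_diff_count: "(\<Sum>x\<in>UNIV. real (diff_count A x)) = real (card A) ^ 2"
proof -
  have "(\<Sum>x\<in>UNIV. real (diff_count A x)) =
      (\<Sum>b\<in>A. \<Sum>a\<in>A. \<Sum>x\<in>UNIV. if b - a = x then 1 else 0)"
    unfolding diff_count_eq_sum
    by (subst sum.swap, rule sum.cong[OF refl], rule sum.swap)
  then show ?thesis by (simp add: power2_eq_square)
qed

text \<open>The convention for \<open>j = 1\<close> fits the general formula, since each pair of
  elements of \<open>A\<close> has exactly one difference.\<close>

lemma energy_eq_sum: "j \<noteq> 0 \<Longrightarrow> energy j A = (\<Sum>x\<in>UNIV. real (diff_count A x) ^ j)"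
  by (auto simp: energy_def sum_diff_count)

definition spectral_weight :: "'a::{ab_group_add,finite} set \<Rightarrow> ('a \<Rightarrow> complex) \<Rightarrow> real" where
  "spectral_weight A \<chi> = norm (set_fourier A \<chi>) ^ 2 / CARD('a)"

lemma spectral_weight_nonneg [simp]: "spectral_weight A \<chi> \<ge> 0"
  by (simp add: spectral_weight_def)

text \<open>Fourier inversion: the squared coefficient expands into characters at differences of
  elements of \<open>A\<close>, and summing over the dual group detects
  \<open>b - a = x\<close>.\<close>

lemma diff_count_char_sum:
  fixes A :: "'a::{ab_group_add,finite} set"
  shows "of_nat (diff_count A x) = char_sum (\<lambda>\<chi>. of_real (spectral_weight A \<chi>)) x"
proof -
  have summand: "of_real (norm (set_fourier A \<chi>) ^ 2) * \<chi> x = (\<Sum>b\<in>A. \<Sum>a\<in>A. \<chi> (x + a - b))"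
    if "\<chi> \<in> characters" for \<chi> :: "'a \<Rightarrow> complex"
  proof -
    have shift: "\<chi> (x + a - b) = cnj (\<chi> b) * \<chi> a * \<chi> x" for a b
      using characterD(1)[OF that, of "x + a" "- b"] characterD(1)[OF that, of x a]
        characterD(5)[OF that, of b] by simp
    show ?thesis
      unfolding shift complex_norm_square set_fourier_eq cnj_sum complex_cnj_cnj
      by (subst sum_product) (simp only: sum_distrib_right)
  qed
  have "(\<Sum>\<chi>\<in>characters. of_real (norm (set_fourier A \<chi>) ^ 2) * \<chi> x) =
      (\<Sum>\<chi>\<in>characters. \<Sum>b\<in>A. \<Sum>a\<in>A. \<chi> (x + a - b))"
    by (intro sum.cong refl summand)
  also have "\<dots> = (\<Sum>b\<in>A. \<Sum>a\<in>A. \<Sum>\<chi>\<in>characters. \<chi> (x + a - b))"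
    by (subst sum.swap, rule sum.cong[OF refl], rule sum.swap)
  also have "\<dots> = (\<Sum>b\<in>A. \<Sum>a\<in>A. of_nat CARD('a) * (if b - a = x then 1 else 0))"
    by (intro sum.cong refl) (auto simp: sum_over_characters algebra_simps)
  also have "\<dots> = of_nat CARD('a) * of_nat (diff_count A x)"
    unfolding diff_count_eq_sum by (simp only: sum_distrib_left)
  finally have "of_nat (diff_count A x) =
      (\<Sum>\<chi>\<in>characters. of_real (norm (set_fourier A \<chi>) ^ 2) * \<chi> x) / of_nat CARD('a)"
    by simp
  then show ?thesis
    by (simp add: char_sum_def spectral_weight_def sum_divide_distrib)
qed

text \<open>The subtracted constant is the mean of \<open>diff_count A\<close>, that is, the
  contribution of the trivial character.\<close>

definition balanced :: "'a::{ab_group_add,finite} set \<Rightarrow> 'a \<Rightarrow> real" where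
  "balanced A x = real (diff_count A x) - real (card A) ^ 2 / CARD('a)"

lemma balanced_char_sum:
  fixes A :: "'a::{ab_group_add,finite} set"
  shows "of_real (balanced A x) =
    char_sum (\<lambda>\<chi>. of_real (if \<chi> = triv_char then 0 else spectral_weight A \<chi>)) x"
proof -
  have "char_sum (\<lambda>\<chi>. of_real (spectral_weight A \<chi>)) x =
      char_sum (\<lambda>\<chi>. of_real (if \<chi> = triv_char then 0 else spectral_weight A \<chi>)) x
      + char_sum (\<lambda>\<chi>. if \<chi> = triv_char then of_real (spectral_weight A triv_char) else 0) x"
    unfolding char_sum_def sum.distrib[symmetric] by (intro sum.cong) auto
  then show ?thesis
    by (simp only: balanced_def diff_count_char_sum[symmetric] char_sum_single)
      (simp add: spectral_weight_def set_fourier_triv)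
qed

lemma majorised_diff_count:
  "majorised (\<lambda>x. of_nat (diff_count A x)) (\<lambda>x. of_nat (diff_count A x))"
  unfolding majorised_def diff_count_char_sum
  by (intro exI[of _ "\<lambda>\<chi>. of_real (spectral_weight A \<chi>)"] exI[of _ "spectral_weight A"]) simp

lemma majorised_balanced:
  "majorised (\<lambda>x. of_real (balanced A x)) (\<lambda>x. of_real (balanced A x))"
  unfolding majorised_def balanced_char_sum
  by (intro exI[of _ "\<lambda>\<chi>. of_real (if \<chi> = triv_char then 0 else spectral_weight A \<chi>)"]
      exI[of _ "\<lambda>\<chi>. if \<chi> = triv_char then 0 else spectral_weight A \<chi>"]) simp

text \<open>For odd \<open>n\<close> the summands may be negative; positive definiteness of the
  power is what gives the sign.\<close>

lemma sum_balanced_power_nonneg: "(\<Sum>x\<in>UNIV. balanced A x ^ n) \<ge> 0"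
  using majorised_power[OF majorised_balanced, of A n]
  by (intro positive_definite_sum_nonneg) simp

lemma energy_ge_balanced:
  fixes A :: "'a::{ab_group_add,finite} set"
  assumes "n \<ge> 1"
  shows "energy n A \<ge> CARD('a) * (real (card A) ^ 2 / CARD('a)) ^ n + (\<Sum>x\<in>UNIV. balanced A x ^ n)"
proof -
  define m where "m = real (card A) ^ 2 / CARD('a)"
  have m: "m \<ge> 0" by (simp add: m_def)
  define t where "t i = of_nat (n choose i) * m ^ (n - i) * (\<Sum>x\<in>UNIV. balanced A x ^ i)" for i
  have "energy n A = (\<Sum>x\<in>UNIV. (balanced A x + m) ^ n)"
    using assms by (simp add: energy_eq_sum balanced_def m_def)
  also have "\<dots> = (\<Sum>i\<le>n. t i)"
    unfolding binomial_ring t_def by (subst sum.swap) (simp add: sum_distrib_left mult_ac)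
  also have "\<dots> \<ge> (\<Sum>i\<in>{0, n}. t i)"
    using m by (intro sum_mono2) (auto simp: t_def sum_balanced_power_nonneg)
  \<comment> \<open>Here \<open>n \<ge> 1\<close> keeps the indices 0 and \<open>n\<close>
    distinct.\<close>
  moreover have "(\<Sum>i\<in>{0, n}. t i) = CARD('a) * m ^ n + (\<Sum>x\<in>UNIV. balanced A x ^ n)"
    using assms by (simp add: t_def)
  ultimately show ?thesis by (simp add: m_def)
qed

lemma density_pos: "A \<noteq> {} \<Longrightarrow> density A > 0"
  by (simp add: density_def card_gt_0_iff)

lemma density_le_1: "density A \<le> 1"
  by (simp add: density_def card_mono)

lemma kappa_ge_balanced:
  fixes A :: "'a::{ab_group_add,finite} set"
  assumes "A \<noteq> {}" "n \<ge> 1"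
  shows "kappa n A - density A ^ (n - 1) \<ge> (\<Sum>x\<in>UNIV. balanced A x ^ n) / card A ^ (n + 1)"
proof -
  have a: "real (card A) > 0" using assms(1) by (simp add: card_gt_0_iff)
  obtain m where n: "n = Suc m" using assms(2) by (cases n) auto
  have "CARD('a) * (real (card A) ^ 2 / CARD('a)) ^ n / card A ^ (n + 1) = density A ^ (n - 1)"
    using assms(1) unfolding n density_def
    by (simp add: field_simps power_divide power2_eq_square power_mult_distrib)
  with divide_right_mono[OF energy_ge_balanced[OF assms(2), of A], of "real (card A ^ (n + 1))"]
  show ?thesis by (simp add: kappa_def add_divide_distrib)
qed

lemma kappa_ge_density_power:
  assumes "A \<noteq> {}" "n \<ge> 1"
  shows "kappa n A \<ge> density A ^ (n - 1)"
proof -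
  have "(\<Sum>x\<in>UNIV. balanced A x ^ n) / card A ^ (n + 1) \<ge> 0"
    using sum_balanced_power_nonneg[of A n] by simp
  with kappa_ge_balanced[OF assms] show ?thesis by linarith
qed

lemma kappa_1: "A \<noteq> {} \<Longrightarrow> kappa (Suc 0) A = 1"
  by (simp add: kappa_def energy_def power2_eq_square)

section \<open>The number of large Fourier coefficients\<close>

text \<open>Jensen's inequality with equal weights; an even power is convex on the whole real
  line.\<close>

lemma sum_power_even_le:
  fixes f :: "'b \<Rightarrow> real"
  assumes "finite S" "S \<noteq> {}" "even n" "n > 0"
  shows "(\<Sum>x\<in>S. f x) ^ n \<le> card S ^ (n - 1) * (\<Sum>x\<in>S. f x ^ n)"
proof -
  have c: "real (card S) > 0" using assms by (simp add: card_gt_0_iff)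
  have "(\<Sum>x\<in>S. (1 / card S) *\<^sub>R f x) ^ n \<le> (\<Sum>x\<in>S. 1 / card S * f x ^ n)"
    using assms c by (intro convex_on_sum[where f = "\<lambda>x. x ^ n" and C = UNIV] convex_power_even) auto
  then have "(\<Sum>x\<in>S. f x) ^ n / card S ^ n \<le> (\<Sum>x\<in>S. f x ^ n) / card S"
    by (simp add: power_divide flip: sum_divide_distrib)
  then have "(\<Sum>x\<in>S. f x) ^ n \<le> card S ^ n * ((\<Sum>x\<in>S. f x ^ n) / card S)"
    using c by (simp add: pos_divide_le_eq mult.commute)
  also have "\<dots> = card S ^ (n - 1) * (\<Sum>x\<in>S. f x ^ n)"
    using c assms(4) by (cases n) auto
  finally show ?thesis .
qed

text \<open>
  \<open>F\<close> is the sum of the characters in the large spectrum, twisted by phases that make the sum of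
  \<open>F\<close> over \<open>A\<close> large. Up to a constant its coefficients lie below those of the balanced
  difference function.
\<close>
lemma sum_balanced_power_ge:
  fixes A :: "'a::{ab_group_add,finite} set" and \<alpha> :: real
  assumes "A \<noteq> {}" "\<alpha> > 0" "k \<ge> 1"
  shows "(\<Sum>x\<in>UNIV. balanced A x ^ (2 * k)) * card A ^ (2 * k - 1) \<ge>
    (\<alpha> ^ 2 * card A ^ 2 / CARD('a)) ^ (2 * k) * (\<alpha> * card A * card (large_spec \<alpha> A)) ^ (2 * k)"
proof -
  let ?R = "large_spec \<alpha> A"
  \<comment> \<open>A lower bound for \<open>spectral_weight A\<close> on the large
    spectrum.\<close>
  define \<beta> where "\<beta> = \<alpha> ^ 2 * card A ^ 2 / CARD('a)"
  define F where "F = char_sum (\<lambda>\<chi>. if \<chi> \<in> ?R then sgn (set_fourier A \<chi>) else 0)"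
  have R: "?R \<subseteq> characters" by (auto simp: large_spec_def)
  then have F: "F x = (\<Sum>\<chi>\<in>?R. sgn (set_fourier A \<chi>) * \<chi> x)" for x
    unfolding F_def char_sum_def
    by (intro sum.mono_neutral_cong_right) auto
  \<comment> \<open>A character sums over \<open>A\<close> to the conjugate of its Fourier
    coefficient, so the phase \<open>sgn\<close> turns each contribution into an absolute
    value.\<close>
  have "(\<Sum>x\<in>A. F x) = (\<Sum>\<chi>\<in>?R. sgn (set_fourier A \<chi>) * cnj (set_fourier A \<chi>))"
    unfolding F by (subst sum.swap) (simp add: sum_distrib_left set_fourier_eq)
  also have "\<dots> = of_real (\<Sum>\<chi>\<in>?R. norm (set_fourier A \<chi>))"
    unfolding of_real_sum
  proof (intro sum.cong refl)
    fix \<chi>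
    show "sgn (set_fourier A \<chi>) * cnj (set_fourier A \<chi>) = of_real (norm (set_fourier A \<chi>))"
      by (cases "set_fourier A \<chi> = 0")
        (auto simp: sgn_eq complex_norm_square[symmetric] power2_eq_square)
  qed
  finally have sum_F: "(\<Sum>x\<in>A. F x) = of_real (\<Sum>\<chi>\<in>?R. norm (set_fourier A \<chi>))" .
  have "\<alpha> * card A * card ?R = (\<Sum>\<chi>\<in>?R. \<alpha> * card A)" by simp
  also have "\<dots> \<le> (\<Sum>\<chi>\<in>?R. norm (set_fourier A \<chi>))"
    by (intro sum_mono) (auto simp: large_spec_def)
  also have "\<dots> \<le> norm (\<Sum>x\<in>A. F x)" unfolding sum_F norm_of_real by simp
  also have "\<dots> \<le> (\<Sum>x\<in>A. norm (F x))" by (rule norm_sum)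
  finally have "(\<alpha> * card A * card ?R) ^ (2 * k) \<le> (\<Sum>x\<in>A. norm (F x)) ^ (2 * k)"
    using assms(2) by (intro power_mono) auto
  also have "\<dots> \<le> card A ^ (2 * k - 1) * (\<Sum>x\<in>A. norm (F x) ^ (2 * k))"
    using assms by (intro sum_power_even_le) auto
  also have "\<dots> \<le> card A ^ (2 * k - 1) * (\<Sum>x\<in>UNIV. norm (F x) ^ (2 * k))"
    by (intro mult_left_mono sum_mono2) auto
  finally have "\<beta> ^ (2 * k) * (\<alpha> * card A * card ?R) ^ (2 * k) \<le>
      \<beta> ^ (2 * k) * (card A ^ (2 * k - 1) * (\<Sum>x\<in>UNIV. norm (F x) ^ (2 * k)))"
    by (intro mult_left_mono) (auto simp: \<beta>_def)
  also have "\<dots> = card A ^ (2 * k - 1) * (\<Sum>x\<in>UNIV. norm (of_real \<beta> * F x) ^ (2 * k))"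
    by (simp add: norm_mult power_mult_distrib power_even_abs mult_ac flip: sum_distrib_left)
  also have "\<dots> \<le> card A ^ (2 * k - 1) * (\<Sum>x\<in>UNIV. balanced A x ^ (2 * k))"
  proof (rule mult_left_mono)
    \<comment> \<open>On the large spectrum the coefficient has norm at most \<beta>. The trivial
      character, whose balanced coefficient is 0, is excluded from
      \<open>large_spec\<close>.\<close>
    have "majorised (\<lambda>x. of_real \<beta> * F x) (\<lambda>x. of_real (balanced A x))"
      unfolding majorised_def
    proof (intro exI conjI ballI allI)
      fix \<chi> :: "'a \<Rightarrow> complex" assume "\<chi> \<in> characters"
      show "norm (of_real \<beta> * (if \<chi> \<in> ?R then sgn (set_fourier A \<chi>) else 0)) \<le>
          (if \<chi> = triv_char then 0 else spectral_weight A \<chi>)"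
      proof (cases "\<chi> \<in> ?R")
        case True
        have "(\<alpha> * card A) ^ 2 \<le> norm (set_fourier A \<chi>) ^ 2"
          using True assms(2) by (intro power_mono) (auto simp: large_spec_def)
        then have "\<beta> \<le> spectral_weight A \<chi>"
          by (simp add: \<beta>_def spectral_weight_def power_mult_distrib divide_right_mono)
        moreover have "\<beta> \<ge> 0" by (simp add: \<beta>_def)
        ultimately show ?thesis using True by (simp add: norm_mult norm_sgn large_spec_def)
      qed simp
    next
      fix x
      show "of_real \<beta> * F x =
          char_sum (\<lambda>\<chi>. of_real \<beta> * (if \<chi> \<in> ?R then sgn (set_fourier A \<chi>) else 0)) x"
        by (simp add: F_def char_sum_def sum_distrib_left mult.assoc)
    qed (rule balanced_char_sum)
    from majorised_sum_norm_square[OF majorised_power[OF this, of k]]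
    show "(\<Sum>x\<in>UNIV. norm (of_real \<beta> * F x) ^ (2 * k)) \<le> (\<Sum>x\<in>UNIV. balanced A x ^ (2 * k))"
      by (simp add: norm_power power_even_abs mult.commute[of 2] flip: power_mult)
  qed simp
  finally show ?thesis by (simp add: \<beta>_def mult_ac)
qed

text \<open>Of the factor \<open>\<alpha> ^ 3\<close>, two powers come from the spectral weights and
  one from the sum of \<open>F\<close> over \<open>A\<close>. All powers of \<open>card A\<close>
  beyond the normalisation of \<open>kappa\<close> cancel before the root is taken.\<close>

lemma large_spec_bound:
  fixes A :: "'a::{ab_group_add,finite} set"
  assumes A: "A \<noteq> {}" and \<alpha>: "\<alpha> > 0" and k: "k \<ge> 1"
  shows "real (card (large_spec \<alpha> A)) \<le>
    \<alpha> powr (-3) * inverse (density A) * root (2 * k) (kappa (2 * k) A - density A ^ (2 * k - 1))"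
proof -
  have a: "real (card A) > 0" using A by (simp add: card_gt_0_iff)
  let ?r = "real (card (large_spec \<alpha> A))" and ?n = "2 * k"
  let ?S = "\<Sum>x\<in>UNIV. balanced A x ^ ?n"
  obtain m where m: "?n = Suc m" using k by (cases "2 * k") auto
  have "(?r * \<alpha> ^ 3 * density A) ^ ?n * (card A ^ (?n + 1) * card A ^ (?n - 1)) =
      (\<alpha> ^ 2 * card A ^ 2 / CARD('a)) ^ ?n * (\<alpha> * card A * ?r) ^ ?n"
  proof -
    have "(\<alpha> ^ 2 * card A ^ 2 / CARD('a)) * (\<alpha> * card A * ?r) =
        (?r * \<alpha> ^ 3 * density A) * (real (card A) ^ 2)"
      by (simp add: density_def power2_eq_square power3_eq_cube)
    moreover have "real (card A ^ (?n + 1) * card A ^ (?n - 1)) = (real (card A) ^ 2) ^ ?n"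
      unfolding m by (simp add: power2_eq_square power_mult_distrib mult_ac)
    ultimately show ?thesis by (simp flip: power_mult_distrib)
  qed
  also have "\<dots> \<le> ?S * card A ^ (?n - 1)"
    using sum_balanced_power_ge[OF A \<alpha> k] by simp
  finally have "(?r * \<alpha> ^ 3 * density A) ^ ?n * card A ^ (?n + 1) \<le> ?S"
    using a by simp
  then have "(?r * \<alpha> ^ 3 * density A) ^ ?n \<le> ?S / card A ^ (?n + 1)"
    using a by (simp add: field_simps)
  also have "\<dots> \<le> kappa ?n A - density A ^ (?n - 1)"
    using k by (intro kappa_ge_balanced[OF A]) simp
  finally have "root ?n ((?r * \<alpha> ^ 3 * density A) ^ ?n) \<le>
      root ?n (kappa ?n A - density A ^ (?n - 1))"
    using k by simp
  then have "?r * \<alpha> ^ 3 * density A \<le> root ?n (kappa ?n A - density A ^ (?n - 1))"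
    using k \<alpha> density_pos[OF A] by (simp add: real_root_power_cancel)
  moreover have "\<alpha> powr (-3) = inverse (\<alpha> ^ 3)"
    using \<alpha> by (simp add: powr_minus flip: powr_numeral)
  ultimately show ?thesis
    using \<alpha> density_pos[OF A] by (simp only:) (simp add: field_simps)
qed

section \<open>The largest nontrivial Fourier coefficient\<close>

lemma norm_set_fourier_le_max:
  "\<chi> \<in> characters \<Longrightarrow> \<chi> \<noteq> triv_char \<Longrightarrow> norm (set_fourier A \<chi>) \<le> max_nontriv_coeff A"
  unfolding max_nontriv_coeff_def by (intro Max_ge) auto

text \<open>The point is that the maximum is over a nonempty set: a group with a nonzero element has
  a nontrivial character.\<close>

lemma max_nontriv_coeff_nonneg:
  fixes A :: "'a::{ab_group_add,finite} set"
  assumes "CARD('a) \<ge> 2"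
  shows "max_nontriv_coeff A \<ge> 0"
proof -
  have "(UNIV :: 'a set) \<noteq> {0}" using assms by (metis card.empty card_insert_disjoint empty_iff
      finite.emptyI numeral_2_eq_2 Suc_n_not_le_n One_nat_def)
  then obtain g :: 'a where "g \<noteq> 0" by auto
  then obtain \<chi> where "\<chi> \<in> characters" "\<chi> g \<noteq> 1" using characters_separate by blast
  then have "norm (set_fourier A \<chi>) \<le> max_nontriv_coeff A"
    by (intro norm_set_fourier_le_max) auto
  then show ?thesis using norm_ge_zero order_trans by blast
qed

text \<open>
  The powers of the difference function have nonnegative Fourier coefficients, which add up to
  the value at \<open>0\<close>.
\<close>
lemma sum_power_mult_balanced_le:
  fixes A :: "'a::{ab_group_add,finite} set"
  shows "(\<Sum>x\<in>UNIV. real (diff_count A x) ^ n * balanced A x) \<le> max_nontriv_coeff A ^ 2 * card A ^ n"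
proof -
  let ?M = "max_nontriv_coeff A"
  let ?w = "\<lambda>\<chi>. if \<chi> = triv_char then 0 else spectral_weight A \<chi>"
  obtain p q where pq: "\<And>\<chi>. \<chi> \<in> characters \<Longrightarrow> norm (p \<chi> :: complex) \<le> q \<chi>"
      "\<And>x. of_nat (diff_count A x) ^ n = char_sum (\<lambda>\<chi>. of_real (q \<chi>)) x"
    using majorised_power[OF majorised_diff_count, of A n] unfolding majorised_def by blast
  have q: "q \<chi> \<ge> 0" if "\<chi> \<in> characters" for \<chi>
    using order_trans[OF norm_ge_zero pq(1)[OF that]] .
  \<comment> \<open>Evaluation at 0, where every character is 1 and \<open>diff_count A\<close>
    equals \<open>card A\<close>.\<close>
  have "(of_real (real (card A) ^ n) :: complex) = of_real (\<Sum>\<chi>\<in>characters. q \<chi>)"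
    using pq(2)[of 0] by (simp add: diff_count_0 char_sum_def characterD(3))
  then have sum_q: "real (card A) ^ n = (\<Sum>\<chi>\<in>characters. q \<chi>)"
    by (simp only: of_real_eq_iff)
  have "of_real (\<Sum>x\<in>UNIV. real (diff_count A x) ^ n * balanced A x) =
      (\<Sum>x\<in>UNIV. char_sum (\<lambda>\<chi>. of_real (q \<chi>)) x * cnj (char_sum (\<lambda>\<chi>. of_real (?w \<chi>)) x))"
    by (simp flip: pq(2) balanced_char_sum)
  also have "\<dots> = of_real (CARD('a) * (\<Sum>\<chi>\<in>characters. q \<chi> * ?w \<chi>))"
    unfolding parseval by simp
  finally have "(\<Sum>x\<in>UNIV. real (diff_count A x) ^ n * balanced A x) =
      CARD('a) * (\<Sum>\<chi>\<in>characters. q \<chi> * ?w \<chi>)"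
    by (simp only: of_real_eq_iff)
  \<comment> \<open>Each nontrivial weight is at most \<open>?M ^ 2 / CARD('a)\<close>, and the
    trivial one has been set to 0.\<close>
  also have "\<dots> \<le> CARD('a) * (\<Sum>\<chi>\<in>characters. q \<chi> * (?M ^ 2 / CARD('a)))"
  proof (intro mult_left_mono sum_mono)
    fix \<chi> :: "'a \<Rightarrow> complex" assume \<chi>: "\<chi> \<in> characters"
    show "?w \<chi> \<le> ?M ^ 2 / CARD('a)"
      using norm_set_fourier_le_max[OF \<chi>, of A]
      by (auto simp: spectral_weight_def intro!: divide_right_mono power_mono)
  qed (auto simp: q)
  also have "\<dots> = ?M ^ 2 * card A ^ n"
    by (simp add: sum_q flip: sum_distrib_right sum_divide_distrib)
  finally show ?thesis .
qed

text \<open>Up to normalisation, the left side pairs the \<open>n\<close>-th power of the difference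
  function with its balanced part.\<close>

lemma kappa_Suc_le:
  fixes A :: "'a::{ab_group_add,finite} set"
  assumes "A \<noteq> {}" "n \<ge> 1"
  shows "kappa (Suc n) A - density A * kappa n A \<le> (max_nontriv_coeff A / card A) ^ 2"
proof -
  have a: "real (card A) > 0" using assms(1) by (simp add: card_gt_0_iff)
  have "kappa (Suc n) A - density A * kappa n A =
      (energy (Suc n) A - real (card A) ^ 2 / CARD('a) * energy n A) / card A ^ (n + 2)"
    using a by (simp add: kappa_def density_def field_simps power2_eq_square)
  also have "energy (Suc n) A - real (card A) ^ 2 / CARD('a) * energy n A =
      (\<Sum>x\<in>UNIV. real (diff_count A x) ^ n * balanced A x)"
    using assms(2)
    by (simp add: energy_eq_sum balanced_def right_diff_distrib sum_subtractf sum_distrib_left mult_ac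
        flip: sum_divide_distrib)
  also have "\<dots> / card A ^ (n + 2) \<le> (max_nontriv_coeff A ^ 2 * card A ^ n) / card A ^ (n + 2)"
    using sum_power_mult_balanced_le[where n = n and A = A] by (intro divide_right_mono) auto
  also have "\<dots> = (max_nontriv_coeff A / card A) ^ 2"
    using a by (simp add: power_divide power_add power2_eq_square)
  finally show ?thesis .
qed

text \<open>Telescoping: the next difference is the left side of \<open>kappa_Suc_le\<close> plus
  \<open>density A\<close> times the current difference, and \<open>density A\<close> is at most 1.
  The base case is 0 because \<kappa>_1 = 1.\<close>

lemma kappa_minus_density_power_le:
  fixes A :: "'a::{ab_group_add,finite} set"
  assumes "A \<noteq> {}"
  shows "kappa (Suc n) A - density A ^ n \<le> n * (max_nontriv_coeff A / card A) ^ 2"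
proof (induction n)
  case 0
  show ?case using kappa_1[OF assms] by simp
next
  case (Suc n)
  let ?M = "(max_nontriv_coeff A / card A) ^ 2"
  have "density A * (kappa (Suc n) A - density A ^ n) \<le> density A * (n * ?M)"
    using Suc.IH density_pos[OF assms] by (intro mult_left_mono) auto
  also have "\<dots> \<le> n * ?M"
    using mult_right_mono[OF density_le_1, of "n * ?M" A] by simp
  finally have "density A * (kappa (Suc n) A - density A ^ n) \<le> n * ?M" .
  moreover have "kappa (Suc (Suc n)) A - density A * kappa (Suc n) A \<le> ?M"
    using kappa_Suc_le[OF assms, of "Suc n"] by simp
  ultimately show ?case by (simp add: algebra_simps)
qed

lemma sqrt_mult_le_max_nontriv_coeff:
  fixes A :: "'a::{ab_group_add,finite} set"
  assumes "CARD('a) \<ge> 2" "A \<noteq> {}" "t \<le> (max_nontriv_coeff A / card A) ^ 2"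
  shows "sqrt t * real (card A) \<le> max_nontriv_coeff A"
proof -
  have a: "real (card A) > 0" using assms(2) by (simp add: card_gt_0_iff)
  have "sqrt t \<le> max_nontriv_coeff A / card A"
    using max_nontriv_coeff_nonneg[OF assms(1), of A] assms(3) by (intro real_le_lsqrt) auto
  then show ?thesis using a by (simp add: field_simps)
qed

lemma max_nontriv_coeff_ge_kappa:
  fixes A :: "'a::{ab_group_add,finite} set"
  assumes "CARD('a) \<ge> 2" "A \<noteq> {}" "k \<ge> 1"
  shows "inverse (sqrt (real k)) * sqrt (kappa k A - density A ^ (k - 1)) * real (card A)
    \<le> max_nontriv_coeff A"
proof -
  let ?M = "(max_nontriv_coeff A / card A) ^ 2"
  obtain n where n: "k = Suc n" using assms(3) by (cases k) auto
  have "kappa k A - density A ^ (k - 1) \<le> n * ?M"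
    using kappa_minus_density_power_le[OF assms(2), of n] n by simp
  \<comment> \<open>Telescoping gives the factor \<open>k - 1\<close>, relaxed here to
    \<open>k\<close>.\<close>
  also have "\<dots> \<le> k * ?M" using n by (intro mult_right_mono) auto
  finally have "(kappa k A - density A ^ (k - 1)) / k \<le> ?M"
    using assms(3) by (simp add: field_simps)
  from sqrt_mult_le_max_nontriv_coeff[OF assms(1,2) this] show ?thesis
    by (simp add: real_sqrt_divide field_simps)
qed

section \<open>Log-convexity of the normalised energies\<close>

lemma kappa_pos:
  assumes "A \<noteq> {}" "n \<ge> 1"
  shows "kappa n A > 0"
  using kappa_ge_density_power[OF assms] zero_less_power[OF density_pos[OF assms(1)], of "n - 1"]
  by linarith

text \<open>Cauchy-Schwarz; square roots of \<open>diff_count\<close> supply the half-integral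
  exponents.\<close>

lemma kappa_log_convex:
  assumes "A \<noteq> {}"
  shows "kappa (Suc (Suc n)) A ^ 2 \<le> kappa (Suc n) A * kappa (Suc (Suc (Suc n))) A"
proof -
  let ?s = "\<lambda>x. sqrt (real (diff_count A x))"
  have even: "(?s x ^ j)\<^sup>2 = real (diff_count A x) ^ j" for x j
    by (simp add: mult.commute[of _ 2] power_mult flip: power_mult) (simp add: power_mult)
  have "?s x ^ Suc n * ?s x ^ Suc (Suc (Suc n)) = (?s x ^ Suc (Suc n))\<^sup>2" for x
    by (simp add: power2_eq_square mult_ac)
  then have "(\<Sum>x\<in>UNIV. (?s x ^ Suc (Suc n))\<^sup>2)\<^sup>2 \<le>
      (\<Sum>x\<in>UNIV. (?s x ^ Suc n)\<^sup>2) * (\<Sum>x\<in>UNIV. (?s x ^ Suc (Suc (Suc n)))\<^sup>2)"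
    using Cauchy_Schwarz_ineq_sum[of "\<lambda>x. ?s x ^ Suc n" "\<lambda>x. ?s x ^ Suc (Suc (Suc n))" UNIV]
    by (simp only:)
  then have *: "energy (Suc (Suc n)) A ^ 2 \<le> energy (Suc n) A * energy (Suc (Suc (Suc n))) A"
    unfolding even by (simp only: energy_eq_sum nat.distinct simp_thms)
  have square: "(real (card A) ^ (n + 3)) ^ 2 = real (card A) ^ (n + 2) * real (card A) ^ (n + 4)"
    by (simp add: numeral_eq_Suc mult_2_right flip: power_mult power_add)
  have "kappa (Suc (Suc n)) A ^ 2 = energy (Suc (Suc n)) A ^ 2 / (real (card A) ^ (n + 3)) ^ 2"
    by (simp add: kappa_def power_divide numeral_eq_Suc)
  also have "\<dots> \<le> energy (Suc n) A * energy (Suc (Suc (Suc n))) A / (real (card A) ^ (n + 3)) ^ 2"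
    using * by (intro divide_right_mono) auto
  also have "\<dots> = kappa (Suc n) A * kappa (Suc (Suc (Suc n))) A"
    unfolding square by (simp add: kappa_def numeral_eq_Suc)
  finally show ?thesis .
qed

text \<open>The comparison of consecutive \<kappa> with integer exponents. Raise log-convexity to
  the power \<open>Suc n\<close>, insert the induction hypothesis and cancel
  \<open>?y ^ n\<close>.\<close>

lemma kappa_power_le:
  assumes "A \<noteq> {}"
  shows "kappa (Suc n) A ^ Suc n \<le> kappa (Suc (Suc n)) A ^ n"
proof (induction n)
  case 0
  show ?case using kappa_1[OF assms] by simp
next
  case (Suc n)
  let ?x = "kappa (Suc n) A" and ?y = "kappa (Suc (Suc n)) A" and ?z = "kappa (Suc (Suc (Suc n))) A"
  have pos: "?x > 0" "?y > 0" "?z > 0" using kappa_pos[OF assms] by auto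
  have "?y ^ n * ?y ^ Suc (Suc n) = (?y ^ 2) ^ Suc n"
    by (simp add: mult_2 flip: power_mult power_add power_Suc)
  also have "\<dots> \<le> (?x * ?z) ^ Suc n"
    using kappa_log_convex[OF assms] by (intro power_mono) auto
  also have "\<dots> \<le> ?y ^ n * ?z ^ Suc n"
    unfolding power_mult_distrib using Suc.IH pos by (intro mult_right_mono) auto
  finally show ?case using pos by simp
qed

lemma kappa_powr_bounds:
  assumes A: "A \<noteq> {}" and k: "k \<ge> 3"
  shows "kappa (k - 1) A powr (real (k - 1) / real (k - 2)) \<le> kappa k A"
    and "density A * kappa (k - 1) A \<le> kappa (k - 1) A powr (real (k - 1) / real (k - 2))"
proof -
  define m where "m = k - 2"
  have m: "k = Suc (Suc m)" "m \<ge> 1" using k by (auto simp: m_def)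
  let ?x = "kappa (Suc m) A" and ?y = "kappa (Suc (Suc m)) A"
  have pos: "?x > 0" "?y > 0" using kappa_pos[OF A] by auto
  have "?x powr (real (Suc m) / real m) = (?x ^ Suc m) powr (1 / real m)"
    using pos by (simp add: powr_powr del: power_Suc flip: powr_realpow)
  also have "\<dots> \<le> (?y ^ m) powr (1 / real m)"
    using kappa_power_le[OF A, of m] pos by (intro powr_mono2) auto
  also have "\<dots> = ?y" using pos m(2) by (simp add: powr_powr flip: powr_realpow)
  finally show "kappa (k - 1) A powr (real (k - 1) / real (k - 2)) \<le> kappa k A"
    using m by simp
  have d: "density A > 0" using density_pos[OF A] .
  \<comment> \<open>The second bound reduces to \<open>density A \<le> ?x powr (1 / real m)\<close>,
    the \<open>m\<close>-th root of \<open>kappa_ge_density_power\<close>.\<close>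
  have "density A = (density A ^ m) powr (1 / real m)"
    using d m(2) by (simp add: powr_powr flip: powr_realpow)
  also have "\<dots> \<le> ?x powr (1 / real m)"
    using kappa_ge_density_power[OF A, of "Suc m"] d by (intro powr_mono2) auto
  finally have "density A * ?x \<le> ?x powr (1 / real m) * ?x"
    using pos by (intro mult_right_mono) auto
  also have "\<dots> = ?x powr (1 / real m + 1)" using pos by (simp add: powr_add)
  also have "1 / real m + 1 = real (Suc m) / real m" using m(2) by (simp add: field_simps)
  finally show "density A * kappa (k - 1) A \<le> kappa (k - 1) A powr (real (k - 1) / real (k - 2))"
    using m by simp
qed

theorem theorem5:
  fixes A :: "'a::{ab_group_add,finite} set"
  assumes "CARD('a) \<ge> 2" and "A \<noteq> {}"
  shows "(\<forall>k::nat. \<forall>\<alpha>::real. k \<ge> 1 \<longrightarrow> 0 < \<alpha> \<longrightarrow> \<alpha> \<le> 1 \<longrightarrow>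
            real (card (large_spec \<alpha> A)) \<le>
              \<alpha> powr (-3) * inverse (density A) * root (2 * k) (kappa (2 * k) A - density A ^ (2 * k - 1))
          \<and> max_nontriv_coeff A \<ge>
              inverse (sqrt (real k)) * sqrt (kappa k A - density A ^ (k - 1)) * real (card A))
       \<and> (\<forall>k::nat. k \<ge> 3 \<longrightarrow>
            kappa k A \<ge> kappa (k - 1) A powr (real (k - 1) / real (k - 2))
          \<and> kappa (k - 1) A powr (real (k - 1) / real (k - 2)) \<ge> density A * kappa (k - 1) A)
       \<and> (\<forall>k::nat. k \<ge> 2 \<longrightarrow>
            max_nontriv_coeff A \<ge> sqrt (kappa k A - density A * kappa (k - 1) A) * real (card A))"
proof (intro conjI allI impI)
  fix k :: nat and \<alpha> :: real
  assume "k \<ge> 1" "0 < \<alpha>" "\<alpha> \<le> 1"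
  then show "real (card (large_spec \<alpha> A)) \<le>
      \<alpha> powr (-3) * inverse (density A) * root (2 * k) (kappa (2 * k) A - density A ^ (2 * k - 1))"
    and "max_nontriv_coeff A \<ge>
      inverse (sqrt (real k)) * sqrt (kappa k A - density A ^ (k - 1)) * real (card A)"
    using large_spec_bound[OF assms(2)] max_nontriv_coeff_ge_kappa[OF assms] by auto
next
  fix k :: nat
  assume "k \<ge> 3"
  then show "kappa k A \<ge> kappa (k - 1) A powr (real (k - 1) / real (k - 2))"
    and "kappa (k - 1) A powr (real (k - 1) / real (k - 2)) \<ge> density A * kappa (k - 1) A"
    using kappa_powr_bounds[OF assms(2)] by auto
next
  fix k :: nat
  assume "k \<ge> 2"
  then show "max_nontriv_coeff A \<ge> sqrt (kappa k A - density A * kappa (k - 1) A) * real (card A)"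
    using kappa_Suc_le[OF assms(2), of "k - 1"]
    by (intro sqrt_mult_le_max_nontriv_coeff[OF assms]) auto
qed

end
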